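(* Let $\mathrm{Herm}$ denote the set of Hermitian matrix polynomials in $\mathbb{P}_m(\mathbb{C}^{n\times n})$. Let $P\in\mathrm{Herm}$ be regular and let $(\lambda,x)\in\mathbb{C}\times\mathbb{C}^n$ be such that $x^Hx=1$. Set $r:=-P(\lambda)x$, $P_x:=I-xx^H$ and $\Lambda_m:=[1,\lambda,\ldots,\lambda^m]^T$. Then $$\eta_F^{\mathrm{Herm}}(\lambda,x,P)=\begin{cases}\dfrac{\sqrt{2\|r\|_2^2-|x^Hr|^2}}{\|\Lambda_m\|_2}\le\sqrt2\,\eta(\lambda,x,P),&\lambda\in\mathbb{R},\\[2mm] \sqrt{\|\widehat r\|_2^2+\dfrac{2(\|r\|_2^2-|x^Hr|^2)}{\|\Lambda_m\|_2^2}},&\lambda\in\mathbb{C}\setminus\mathbb{R},\end{cases}$$ $$\eta_2^{\mathrm{Herm}}(\lambda,x,P)=\begin{cases}\eta(\lambda,x,P),&\lambda\in\mathbb{R},\\ \sqrt{\|\widehat r\|_2^2+\dfrac{\|r\|_2^2-|x^Hr|^2}{\|\Lambda_m\|_2^2}},&\lambda\in\mathbb{C}\setminus\mathbb{R},\end{cases}$$ where $\widehat r:=\begin{bmatrix}(\operatorname{Re}\Lambda_m)^T\\ (\operatorname{Im}\Lambda_m)^T\end{bmatrix}^\dagger\begin{bmatrix}\operatorname{re}(x^Hr)\\ \operatorname{im}(x^Hr)\end{bmatrix}\in\mathbb{R}^{m+1}$. For the Frobenius norm, for $j=0,\ldots,m$ define $$\Delta A_j:=\begin{cases}\dfrac{\lambda^j}{\|\Lambda_m\|_2^2}\left(xr^H+rx^H-(r^Hx)xx^H\right),&\lambda\in\mathbb{R},\\[2mm]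 e_j^T\widehat r\,xx^H+\dfrac{1}{\|\Lambda_m\|_2^2}\left[\overline{\lambda^j}P_xrx^H+\lambda^jxr^HP_x\right],&\lambda\in\mathbb{C}\setminus\mathbb{R}.\end{cases}$$ Then $\Delta P(z):=\sum_{j=0}^m z^j\Delta A_j$ is the unique Hermitian polynomial in $\mathrm{Herm}$ such that $P(\lambda)x+\Delta P(\lambda)x=0$ and $|||\Delta P|||_F=\eta_F^{\mathrm{Herm}}(\lambda,x,P)$. For the spectral norm, for $j=0,\ldots,m$ define $$\Delta A_j:=\begin{cases}\dfrac{\lambda^j}{\|\Lambda_m\|_2^2}\left(rx^H+xr^H-(r^Hx)xx^H\right)-\dfrac{\lambda^j\,x^Hr\,P_xrr^HP_x}{\|\Lambda_m\|_2^2(\|r\|_2^2-|x^Hr|^2)},&\lambda\in\mathbb{R},\\[2mm] e_j^T\widehat r\,xx^H+\dfrac{1}{\|\Lambda_m\|_2^2}\left[\overline{\lambda^j}P_xrx^H+\lambda^jxr^HP_x\right]-\dfrac{e_j^T\widehat r\,P_xrr^HP_x}{\|r\|_2^2-|x^Hr|^2},&\lambda\in\mathbb{C}\setminus\mathbb{R},\end{cases}$$ where the last term is taken to be $0$ if $|x^Hr|=\|r\|_2$. Then $\Delta P(z):=\sum_{j=0}^m z^j\Delta A_j$ is a Hermitian polynomial in $\mathrm{Herm}$ such that $P(\lambda)x+\Delta P(\lambda)x=0$ and $|||\Delta P|||_2=\eta_2^{\mathrm{Herm}}(\lambda,x,P)$.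
   Context: $m,n\ge1$ are integers. $\mathbb{P}_m(\mathbb{C}^{n\times n})$ is the vector space of matrix polynomials $P(z)=\sum_{j=0}^m z^jA_j$ with $A_j\in\mathbb{C}^{n\times n}$ (degree at most $m$). $P$ is regular if $\det P(z)\ne0$ for some $z\in\mathbb{C}$. $P$ is Hermitian if all coefficients satisfy $A_j^H=A_j$. $\operatorname{Re},\operatorname{Im}$ (for vectors) and $\operatorname{re},\operatorname{im}$ (for scalars) are real and imaginary parts; $A^\dagger$ is the Moore–Penrose pseudo-inverse; $e_0,\ldots,e_m$ is the canonical basis of $\mathbb{C}^{m+1}$; bars denote complex conjugation. For $M\in\{2,F\}$, $|||P|||_M:=\left(\sum_{j=0}^m\|A_j\|_M^2\right)^{1/2}$, where $\|\cdot\|_F$ is the Frobenius norm and $\|\cdot\|_2$ the spectral norm. For $P$ regular, $\lambda\in\mathbb{C}$ and $x\in\mathbb{C}^n$ with $x^Hx=1$, the unstructured backward error is $\eta(\lambda,x,P):=\inf\{|||\Delta P|||_M:\Delta P\in\mathbb{P}_m(\mathbb{C}^{n\times n}),\ P(\lambda)x+\Delta P(\lambda)x=0\}$, which equals $\|P(\lambda)x\|_2/\|\Lambda_m\|_2$ for both $M=2$ and $M=F$. For a structure class $\mathbb{S}\subset\mathbb{P}_m(\mathbb{C}^{n\times n})$ and $P\in\mathbb{S}$ the structured backward error is $\eta_M^{\mathbb{S}}(\lambda,x,P):=\inf\{|||\Delta P|||_M:\Delta P\in\mathbb{S},\ P(\lambda)x+\Delta P(\lambda)x=0\}$. *)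

theory Defs
  imports "HOL-Analysis.Analysis" "HOL-Computational_Algebra.Polynomial" "Jordan_Normal_Form.Matrix"
begin

text \<open>
  \<open>n \<times> n\<close> matrices are those of \<open>HOL-Analysis\<close>, with \<open>n = CARD('n)\<close>. The matrices and vectors of
  \<open>Jordan_Normal_Form\<close> are used only for objects of size \<open>m + 1\<close>, where \<open>m\<close> is a natural number;
  their clashing names and notation are hidden here and written with the prefix \<open>Matrix\<close>.
\<close>

hide_type (open) Matrix.vec Matrix.mat
hide_const (open) Matrix.vec Matrix.mat Matrix.row Matrix.rows
no_notation Matrix.vec_index (infixl \<open>$\<close> 100)
no_notation Matrix.scalar_prod (infix \<open>\<bullet>\<close> 70)

subsection \<open>Complex vectors and matrices\<close>

text \<open>\<open>x\<^sup>H y\<close> and \<open>x y\<^sup>H\<close>\<close>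

definition hdot :: "complex ^ 'n \<Rightarrow> complex ^ 'n \<Rightarrow> complex" where
  "hdot x y = (\<Sum>i\<in>UNIV. cnj (x $ i) * y $ i)"

definition outer :: "complex ^ 'n \<Rightarrow> complex ^ 'n \<Rightarrow> complex ^ 'n ^ 'n" where
  "outer x y = (\<chi> i j. x $ i * cnj (y $ j))"

definition ctranspose :: "complex ^ 'n ^ 'n \<Rightarrow> complex ^ 'n ^ 'n" where
  "ctranspose A = map_matrix cnj (transpose A)"

definition cscale :: "complex \<Rightarrow> complex ^ 'n ^ 'n \<Rightarrow> complex ^ 'n ^ 'n" (infixr \<open>*\<^sub>C\<close> 75) where
  "c *\<^sub>C A = map_matrix ((*) c) A"

text \<open>
  The library norm of \<^typ>\<open>complex ^ 'n ^ 'n\<close> is the \<open>\<ell>\<^sup>2\<close> norm of the \<open>\<ell>\<^sup>2\<close> norms of the rows.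
\<close>

abbreviation frobenius_norm :: "complex ^ 'n ^ 'n \<Rightarrow> real" where
  "frobenius_norm \<equiv> norm"

definition spectral_norm :: "complex ^ 'n ^ 'n \<Rightarrow> real" where
  "spectral_norm A = onorm (\<lambda>v. A *v v)"

subsection \<open>Matrix polynomials\<close>

text \<open>
  The library function \<^const>\<open>poly\<close> is not the evaluation of matrix polynomials: it takes a matrix
  as its argument, and the library product \<open>*\<close> of matrices is componentwise.
\<close>

definition mpoly_eval :: "(complex ^ 'n ^ 'n) poly \<Rightarrow> complex \<Rightarrow> complex ^ 'n ^ 'n" where
  "mpoly_eval P z = (\<Sum>j\<le>degree P. z ^ j *\<^sub>C coeff P j)"

definition matrix_polys :: "nat \<Rightarrow> (complex ^ 'n ^ 'n) poly set" where
  "matrix_polys m = {P. degree P \<le> m}"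

definition regular_mpoly :: "(complex ^ 'n ^ 'n) poly \<Rightarrow> bool" where
  "regular_mpoly P \<longleftrightarrow> (\<exists>z. det (mpoly_eval P z) \<noteq> 0)"

definition herm_polys :: "nat \<Rightarrow> (complex ^ 'n ^ 'n) poly set" where
  "herm_polys m = {P \<in> matrix_polys m. \<forall>j. ctranspose (coeff P j) = coeff P j}"

text \<open>\<open>N\<close> is the matrix norm applied to the coefficients.\<close>

definition mpoly_norm ::
    "nat \<Rightarrow> (complex ^ 'n ^ 'n \<Rightarrow> real) \<Rightarrow> (complex ^ 'n ^ 'n) poly \<Rightarrow> real" where
  "mpoly_norm m N P = sqrt (\<Sum>j\<le>m. (N (coeff P j))\<^sup>2)"

text \<open>
  The backward error with perturbations restricted to \<open>S\<close>; \<^term>\<open>S = matrix_polys m\<close> gives the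
  unstructured one.
\<close>

definition backward_error ::
    "nat \<Rightarrow> (complex ^ 'n ^ 'n \<Rightarrow> real) \<Rightarrow> (complex ^ 'n ^ 'n) poly set \<Rightarrow>
     complex \<Rightarrow> complex ^ 'n \<Rightarrow> (complex ^ 'n ^ 'n) poly \<Rightarrow> real" where
  "backward_error m N S lam x P =
     Inf {mpoly_norm m N \<Delta>P | \<Delta>P.
            \<Delta>P \<in> S \<and> mpoly_eval P lam *v x + mpoly_eval \<Delta>P lam *v x = 0}"

subsection \<open>Vectors of length \<open>m + 1\<close> and the pseudo-inverse\<close>

definition power_vec :: "nat \<Rightarrow> complex \<Rightarrow> complex Matrix.vec" where
  "power_vec m lam = Matrix.vec (m + 1) (\<lambda>j. lam ^ j)"

definition vnorm2 :: "'a::real_normed_field Matrix.vec \<Rightarrow> real" where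
  "vnorm2 v = sqrt (\<Sum>j<dim_vec v. (norm (vec_index v j))\<^sup>2)"

text \<open>The Penrose conditions; for real matrices the conjugate transpose is the transpose.\<close>

definition is_pinv :: "real Matrix.mat \<Rightarrow> real Matrix.mat \<Rightarrow> bool" where
  "is_pinv A X \<longleftrightarrow> X \<in> carrier_mat (dim_col A) (dim_row A) \<and>
     A * X * A = A \<and> X * A * X = X \<and>
     transpose_mat (A * X) = A * X \<and> transpose_mat (X * A) = X * A"

definition pinv :: "real Matrix.mat \<Rightarrow> real Matrix.mat" where
  "pinv A = (THE X. is_pinv A X)"

lemma is_pinv_unique:
  assumes X: "is_pinv A X" and Y: "is_pinv A Y"
  shows "X = Y"
proof -
  define k l where "k = dim_row A" and "l = dim_col A"
  have cA: "A \<in> carrier_mat k l" by (auto simp: k_def l_def)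
  have cX: "X \<in> carrier_mat l k" and cY: "Y \<in> carrier_mat l k"
    using X Y by (auto simp: is_pinv_def k_def l_def)
  have x: "A * X * A = A" "X * A * X = X"
      "transpose_mat (A * X) = A * X" "transpose_mat (X * A) = X * A"
    and y: "A * Y * A = A" "Y * A * Y = Y"
      "transpose_mat (A * Y) = A * Y" "transpose_mat (Y * A) = Y * A"
    using X Y by (auto simp: is_pinv_def)
  have "(A * Y) * (A * X) = A * Y * A * X"
    using cA cX cY by (metis assoc_mult_mat mult_carrier_mat)
  then have 1: "(A * Y) * (A * X) = A * X" by (simp add: y)
  have "(A * X) * (A * Y) = A * X * A * Y"
    using cA cX cY by (metis assoc_mult_mat mult_carrier_mat)
  then have 2: "(A * X) * (A * Y) = A * Y" by (simp add: x)
  have "transpose_mat ((A * X) * (A * Y)) = transpose_mat (A * Y) * transpose_mat (A * X)"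
    using cA cX cY by (meson mult_carrier_mat transpose_mult)
  then have AXY: "A * X = A * Y" using 1 2 x y by simp
  have "(X * A) * (Y * A) = X * (A * Y * A)"
    using cA cX cY by (metis assoc_mult_mat mult_carrier_mat)
  then have 3: "(X * A) * (Y * A) = X * A" by (simp add: y)
  have "(Y * A) * (X * A) = Y * (A * X * A)"
    using cA cX cY by (metis assoc_mult_mat mult_carrier_mat)
  then have 4: "(Y * A) * (X * A) = Y * A" by (simp add: x)
  have "transpose_mat ((X * A) * (Y * A)) = transpose_mat (Y * A) * transpose_mat (X * A)"
    using cA cX cY by (meson mult_carrier_mat transpose_mult)
  then have XYA: "X * A = Y * A" using 3 4 x y by simp
  have "X = Y * A * X" using x(2) XYA by simp
  also have "\<dots> = Y * (A * X)" using cA cX cY by (metis assoc_mult_mat)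
  also have "\<dots> = Y * A * Y" using AXY cA cX cY by (metis assoc_mult_mat)
  finally show ?thesis by (simp add: y)
qed

lemma pinv_eqI: "is_pinv A X \<Longrightarrow> pinv A = X"
  unfolding pinv_def using is_pinv_unique by blast

end

theory Submission
  imports Defs
begin

text \<open>
  For a unit vector \<open>x\<close>, a Hermitian matrix \<open>A\<close> with \<open>A x = w\<close> exists iff \<open>x\<^sup>H w\<close> is
  real; the one of least Frobenius norm is
  \<open>D = w x\<^sup>H + x w\<^sup>H - (x\<^sup>H w) x x\<^sup>H\<close>, because \<open>D\<close> is orthogonal to every Hermitian matrix
  annihilating \<open>x\<close>. It remains to choose the vectors \<open>w\<^sub>j = \<Delta>A\<^sub>j x\<close> subject to
  \<open>\<Sum>j. \<lambda>\<^sup>j w\<^sub>j = r\<close> with \<open>x\<^sup>H w\<^sub>j\<close> real. The components of the \<open>w\<^sub>j\<close> along \<open>x\<close> and orthogonal to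
  \<open>x\<close> decouple, and the minimum norm solutions are \<open>rhat\<close> and \<open>cnj (\<lambda>\<^sup>j) P\<^sub>x r / norm \<Lambda> ^ 2\<close>; these
  are optimal for both norms. For the spectral norm, \<open>norm (\<Delta>A\<^sub>j x)\<close> is a lower bound of the norm of
  \<open>\<Delta>A\<^sub>j\<close>, and it is attained by adding to \<open>D\<close> a rank-one term that makes it a multiple of a
  unitary matrix on the span of \<open>x\<close> and \<open>P\<^sub>x r\<close>. For real \<open>\<lambda>\<close> the number \<open>x\<^sup>H r\<close> is real and
  \<open>rhat\<^sub>j = \<lambda>\<^sup>j x\<^sup>H r / norm \<Lambda> ^ 2\<close>, so the real case is the same computation.
\<close>

subsection \<open>The Hermitian inner product\<close>

lemma hdot_add_left: "hdot (x + y) z = hdot x z + hdot y z"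
  and hdot_add_right: "hdot x (y + z) = hdot x y + hdot x z"
  and hdot_diff_left: "hdot (x - y) z = hdot x z - hdot y z"
  and hdot_diff_right: "hdot x (y - z) = hdot x y - hdot x z"
  by (simp_all add: hdot_def algebra_simps sum.distrib sum_subtractf)

lemma hdot_smult_left: "hdot (c *s x) y = cnj c * hdot x y"
  and hdot_smult_right: "hdot x (c *s y) = c * hdot x y"
  by (simp_all add: hdot_def sum_distrib_left mult_ac)

lemma hdot_sum_right: "hdot x (\<Sum>j\<in>J. f j) = (\<Sum>j\<in>J. hdot x (f j))"
  by (simp add: hdot_def sum_distrib_left) (rule sum.swap)

lemma hdot_zero_right: "hdot x 0 = 0"
  by (simp add: hdot_def)

lemmas hdot_simps = hdot_add_left hdot_add_right hdot_diff_left hdot_diff_right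
  hdot_smult_left hdot_smult_right

lemma cnj_hdot: "cnj (hdot x y) = hdot y x"
  by (simp add: hdot_def mult.commute)

lemma Re_hdot_commute: "Re (hdot x y) = Re (hdot y x)"
  by (metis cnj_hdot complex_cnj_cancel_iff complex_cnj cnj.sel(1))

lemma Re_hdot: "Re (hdot x y) = inner x y"
  by (simp add: hdot_def inner_vec_def inner_complex_def)

lemma hdot_self: "hdot x x = of_real ((norm x)\<^sup>2)"
proof -
  have "Im (hdot x x) = 0"
    by (simp add: hdot_def mult.commute)
  then show ?thesis
    by (simp add: complex_eq_iff Re_hdot power2_norm_eq_inner)
qed

lemma hdot_self_1D:
  assumes "hdot x x = 1"
  shows "norm x = 1"
proof -
  have "(norm x)\<^sup>2 = 1"
    using assms by (metis hdot_self of_real_eq_1_iff)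
  then show ?thesis
    by (simp add: power2_eq_1_iff) (metis norm_ge_zero neg_0_le_iff_le not_one_le_zero)
qed

lemma norm_smult_vec: "norm (c *s (x :: complex ^ 'n)) = cmod c * norm x"
proof -
  have "of_real ((norm (c *s x))\<^sup>2) = complex_of_real ((cmod c * norm x)\<^sup>2)"
    unfolding hdot_self[symmetric] hdot_smult_left hdot_smult_right
    by (simp add: hdot_self power_mult_distrib complex_norm_square mult_ac del: of_real_power)
  then have "(norm (c *s x))\<^sup>2 = (cmod c * norm x)\<^sup>2"
    using of_real_eq_iff by blast
  then show ?thesis
    by (simp add: power2_eq_iff_nonneg)
qed

lemma norm_add_sq_orthogonal:
  assumes "hdot x y = 0"
  shows "(norm (x + y))\<^sup>2 = (norm x)\<^sup>2 + (norm y)\<^sup>2"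
proof -
  have "inner x y = 0"
    using assms by (metis Re_hdot zero_complex.sel(1))
  then show ?thesis
    by (simp add: power2_norm_eq_inner inner_simps inner_commute)
qed

lemma norm_combination_sq_orthogonal:
  assumes "hdot x y = 0"
  shows "(norm (p *s x + q *s y))\<^sup>2 = (cmod p * norm x)\<^sup>2 + (cmod q * norm y)\<^sup>2"
  using norm_add_sq_orthogonal[of "p *s x" "q *s y"] assms
  by (simp add: hdot_simps norm_smult_vec)

subsection \<open>Rank-one and Hermitian matrices\<close>

lemma outer_vector_mult: "outer x y *v z = hdot y z *s x"
  by (simp add: Finite_Cartesian_Product.vec_eq_iff outer_def hdot_def matrix_vector_mult_def sum_distrib_left mult_ac)

lemma sum_matrix_vector_mult: "(\<Sum>j\<in>J. f j) *v x = (\<Sum>j\<in>J. f j *v x)"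
  for f :: "'i \<Rightarrow> complex ^ 'n ^ 'n"
  by (induction J rule: infinite_finite_induct) (simp_all add: matrix_vector_mult_add_rdistrib)

lemma cscale_vector_mult: "(c *\<^sub>C A) *v z = c *s (A *v z)"
  by (simp add: Finite_Cartesian_Product.vec_eq_iff cscale_def map_matrix_def matrix_vector_mult_def sum_distrib_left mult_ac)

lemma cscale_of_real: "of_real c *\<^sub>C A = c *\<^sub>R A"
  unfolding Finite_Cartesian_Product.vec_eq_iff cscale_def map_matrix_def vector_scaleR_component
  by (simp add: scaleR_conv_of_real[where 'a = complex])

lemma matrix_mult_outer: "A ** outer x y = outer (A *v x) y"
  by (simp add: Finite_Cartesian_Product.vec_eq_iff outer_def matrix_matrix_mult_def matrix_vector_mult_def
      sum_distrib_left mult_ac)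

lemma outer_matrix_mult: "outer x y ** A = outer x (ctranspose A *v y)"
  by (simp add: Finite_Cartesian_Product.vec_eq_iff outer_def matrix_matrix_mult_def matrix_vector_mult_def ctranspose_def
      map_matrix_def transpose_def sum_distrib_left mult_ac)

lemma ctranspose_outer: "ctranspose (outer x y) = outer y x"
  by (simp add: Finite_Cartesian_Product.vec_eq_iff outer_def ctranspose_def map_matrix_def transpose_def mult_ac)

lemma ctranspose_add: "ctranspose (A + B) = ctranspose A + ctranspose B"
  and ctranspose_diff: "ctranspose (A - B) = ctranspose A - ctranspose B"
  and ctranspose_scaleR: "ctranspose (c *\<^sub>R A) = c *\<^sub>R ctranspose A"
  and ctranspose_0: "ctranspose 0 = 0"
  and ctranspose_mat_1: "ctranspose (mat 1) = mat 1"
  by (simp_all add: Finite_Cartesian_Product.vec_eq_iff ctranspose_def map_matrix_def transpose_def Finite_Cartesian_Product.mat_def eq_commute)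

lemma hdot_ctranspose: "hdot x (A *v y) = hdot (ctranspose A *v x) y"
  unfolding hdot_def matrix_vector_mult_def ctranspose_def map_matrix_def transpose_def
  by (simp add: sum_distrib_left sum_distrib_right mult_ac) (rule sum.swap)

lemma hdot_hermitian_real:
  assumes "ctranspose A = A"
  shows "hdot x (A *v x) = of_real (Re (hdot x (A *v x)))"
proof -
  have "cnj (hdot x (A *v x)) = hdot x (A *v x)"
    using assms by (metis cnj_hdot hdot_ctranspose)
  then show ?thesis
    by (simp add: complex_eq_iff)
qed

text \<open>The library inner product of matrices is the real Frobenius product, the real part of
  the trace of \<open>A\<^sup>H B\<close>. Pairing with a rank-one matrix only evaluates
  \<open>B\<close>, which reduces Frobenius norms to vector computations.\<close>

lemma inner_outer: "inner (outer x y) B = Re (hdot x (B *v y))"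
  unfolding inner_vec_def outer_def inner_complex_def hdot_def matrix_vector_mult_def
  by (simp add: sum_distrib_left algebra_simps)

text \<open>Taking only the real part of \<open>hdot x w\<close> makes the matrix Hermitian for
  every \<open>w\<close>; it maps a unit vector \<open>x\<close> to \<open>w\<close> once
  \<open>hdot x w\<close> is real.\<close>

definition hermitian_completion :: "complex ^ 'n \<Rightarrow> complex ^ 'n \<Rightarrow> complex ^ 'n ^ 'n" where
  "hermitian_completion x w = outer w x + outer x w - Re (hdot x w) *\<^sub>R outer x x"

lemma ctranspose_hermitian_completion:
  "ctranspose (hermitian_completion x w) = hermitian_completion x w"
  by (simp add: hermitian_completion_def ctranspose_outer ctranspose_add ctranspose_diff
      ctranspose_scaleR)

text \<open>Symmetry of \<open>B\<close> identifies the pairings with \<open>outer w x\<close> and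
  \<open>outer x w\<close>, so the result depends on \<open>B\<close> only through
  \<open>B *v x\<close>. Constraints on the image of \<open>x\<close> therefore control Frobenius
  products.\<close>

lemma inner_hermitian_completion:
  assumes "ctranspose B = B"
  shows "inner (hermitian_completion x w) B
    = 2 * Re (hdot w (B *v x)) - Re (hdot x w) * Re (hdot x (B *v x))"
proof -
  have "Re (hdot x (B *v w)) = Re (hdot w (B *v x))"
    using assms by (metis hdot_ctranspose Re_hdot_commute)
  then show ?thesis
    by (simp add: hermitian_completion_def inner_simps inner_outer)
qed

lemma hermitian_completion_vector_mult:
  assumes "hdot x x = 1" "Im (hdot x w) = 0"
  shows "hermitian_completion x w *v x = w"
proof -
  have "hdot w x = of_real (Re (hdot x w))"
    using assms(2) by (subst cnj_hdot[symmetric]) (simp add: complex_eq_iff)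
  then show ?thesis
    using assms(1)
    by (simp add: hermitian_completion_def matrix_vector_mult_diff_rdistrib matrix_vector_mult_add_rdistrib
        outer_vector_mult cscale_vector_mult flip: cscale_of_real)
qed

lemma norm_hermitian_completion:
  assumes "hdot x x = 1" "Im (hdot x w) = 0"
  shows "(norm (hermitian_completion x w))\<^sup>2 = 2 * (norm w)\<^sup>2 - (cmod (hdot x w))\<^sup>2"
  using assms unfolding power2_norm_eq_inner[of "hermitian_completion x w"]
  by (simp add: inner_hermitian_completion ctranspose_hermitian_completion
      hermitian_completion_vector_mult hdot_self cmod_power2 power2_eq_square[of "Re (hdot x w)"])

lemma frobenius_norm_outer: "norm (outer x y) = norm x * norm y"
proof -
  have "(norm (outer x y))\<^sup>2 = (norm x * norm y)\<^sup>2"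
    unfolding power2_norm_eq_inner[of "outer x y"] inner_outer outer_vector_mult
    by (simp add: hdot_smult_right hdot_self power_mult_distrib)
  then show ?thesis
    by (simp add: power2_eq_iff_nonneg)
qed

subsection \<open>The two matrix norms\<close>

lemma spectral_norm_ge: "norm (A *v x) \<le> spectral_norm A * norm x"
  unfolding spectral_norm_def by (rule onorm) simp

lemma spectral_norm_le:
  assumes "\<And>v. norm (A *v v) \<le> c * norm v"
  shows "spectral_norm A \<le> c"
  unfolding spectral_norm_def by (rule onorm_le) (use assms in \<open>simp add: mult.commute\<close>)

text \<open>Cauchy-Schwarz for the real Frobenius product of \<open>A\<close> with
  \<open>outer (A *v x) x\<close>.\<close>

lemma frobenius_norm_ge: "norm (A *v x) \<le> norm A * norm x" for A :: "complex ^ 'n ^ 'n"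
proof (cases "A *v x = 0")
  case False
  have "(norm (A *v x))\<^sup>2 = inner (outer (A *v x) x) A"
    by (simp add: inner_outer Re_hdot power2_norm_eq_inner)
  also have "\<dots> \<le> norm (A *v x) * norm x * norm A"
    by (metis frobenius_norm_outer norm_cauchy_schwarz)
  finally show ?thesis
    using False by (simp add: power2_eq_square mult_ac)
qed simp

text \<open>Cauchy-Schwarz for the real inner product bounds only the real part; the modulus follows
  from \<open>frobenius_norm_ge\<close> for \<open>outer x x\<close>, which sends \<open>y\<close>
  to \<open>hdot x y *s x\<close>.\<close>

lemma hdot_bound: "cmod (hdot x y) \<le> norm x * norm y"
proof (cases "x = 0")
  case True
  then show ?thesis by (simp add: hdot_def)
next
  case False
  have "cmod (hdot x y) * norm x = norm (outer x x *v y)"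
    by (simp add: outer_vector_mult norm_smult_vec)
  also have "\<dots> \<le> norm x * norm x * norm y"
    by (metis frobenius_norm_ge frobenius_norm_outer)
  finally show ?thesis
    using False by (simp add: mult_ac)
qed

lemma spectral_norm_outer_le: "spectral_norm (outer x y) \<le> norm x * norm y"
proof (rule spectral_norm_le)
  show "norm (outer x y *v v) \<le> norm x * norm y * norm v" for v
    using mult_right_mono[OF hdot_bound[of y v], of "norm x"]
    by (simp add: outer_vector_mult norm_smult_vec mult_ac)
qed

text \<open>
  In an orthonormal basis starting with \<open>x\<close> and \<open>b / norm b\<close> the matrix has the nonzero block
  \<open>[[\<rho>, cnj \<kappa> * norm b], [\<kappa> * norm b, -\<rho>]]\<close>, a multiple of a unitary matrix. For \<open>b = 0\<close> the
  subtracted term is \<open>0\<close>.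
\<close>

lemma spectral_norm_completion_le:
  assumes x: "hdot x x = 1" and xb: "hdot x b = 0"
  shows "spectral_norm (hermitian_completion x (of_real \<rho> *s x + \<kappa> *s b)
           - (\<rho> / (norm b)\<^sup>2) *\<^sub>R outer b b) \<le> norm (of_real \<rho> *s x + \<kappa> *s b)"
    (is "spectral_norm ?B \<le> norm ?w")
proof (rule spectral_norm_le)
  fix v
  define p q \<beta> where "p = hdot x v" and "q = hdot b v" and "\<beta> = norm b"
  have bx: "hdot b x = 0"
    using xb by (metis cnj_hdot complex_cnj_zero)
  have nx: "norm x = 1"
    using x by (rule hdot_self_1D)
  have xw: "hdot x ?w = of_real \<rho>"
    by (simp add: hdot_simps x xb)
  have wv: "hdot ?w v = of_real \<rho> * p + cnj \<kappa> * q"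
    by (simp add: hdot_simps p_def q_def)
  \<comment> \<open>For \<open>b = 0\<close> every quotient by \<open>\<beta>\<close> is 0 by
    convention, in agreement with \<open>q = 0\<close>.\<close>
  have q0: "q = 0" if "\<beta> = 0"
    using that by (simp add: q_def \<beta>_def hdot_def)
  have nw: "(norm ?w)\<^sup>2 = \<rho>\<^sup>2 + (cmod \<kappa> * \<beta>)\<^sup>2"
    by (simp add: norm_combination_sq_orthogonal[OF xb] nx \<beta>_def)
  have "?B *v v = (of_real \<rho> * p + cnj \<kappa> * q) *s x + (\<kappa> * p - of_real (\<rho> / \<beta>\<^sup>2) * q) *s b"
    unfolding hermitian_completion_def xw
    by (simp only: matrix_vector_mult_diff_rdistrib matrix_vector_mult_add_rdistrib
        outer_vector_mult cscale_vector_mult wv p_def[symmetric] q_def[symmetric] \<beta>_def[symmetric]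
        flip: cscale_of_real)
      (simp add: Finite_Cartesian_Product.vec_eq_iff algebra_simps)
  then have "(norm (?B *v v))\<^sup>2
      = (cmod (of_real \<rho> * p + cnj \<kappa> * q))\<^sup>2 + (cmod (\<kappa> * p - of_real (\<rho> / \<beta>\<^sup>2) * q) * \<beta>)\<^sup>2"
    by (simp only: norm_combination_sq_orthogonal[OF xb]) (simp add: nx \<beta>_def)
  \<comment> \<open>The mixed terms in \<open>p\<close> and \<open>q\<close> of the two squares
    cancel; this is the multiple-of-unitary property.\<close>
  also have "\<dots> = (\<rho>\<^sup>2 + (cmod \<kappa> * \<beta>)\<^sup>2) * ((cmod p)\<^sup>2 + (cmod q / \<beta>)\<^sup>2)"
  proof (cases "\<beta> = 0")
    case True
    then show ?thesis by (simp add: q0 norm_mult power_mult_distrib)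
  next
    case False
    then show ?thesis
      unfolding power_mult_distrib power_divide cmod_power2
      by (simp add: field_simps) (simp add: eval_nat_numeral algebra_simps)
  qed
  also have "\<dots> \<le> (norm ?w)\<^sup>2 * (norm v)\<^sup>2"
  proof -
    \<comment> \<open>\<open>s\<close> is the orthogonal projection of \<open>v\<close> onto the
      span of \<open>x\<close> and \<open>b\<close>, so the estimate is Bessel's inequality.\<close>
    define s where "s = p *s x + (of_real (1 / \<beta>\<^sup>2) * q) *s b"
    have ps: "(norm s)\<^sup>2 = (cmod p)\<^sup>2 + (cmod q / \<beta>)\<^sup>2"
      unfolding s_def norm_combination_sq_orthogonal[OF xb] \<beta>_def[symmetric]
      by (simp add: nx norm_mult norm_divide power2_eq_square)
    have sv: "hdot s v = of_real ((norm s)\<^sup>2)"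
      unfolding ps power_divide of_real_add of_real_divide complex_norm_square
      by (simp add: s_def hdot_simps p_def[symmetric] q_def[symmetric] mult_ac)
    have "hdot s (v - s) = 0"
      unfolding hdot_simps sv hdot_self by simp
    then have "(norm (s + (v - s)))\<^sup>2 = (norm s)\<^sup>2 + (norm (v - s))\<^sup>2"
      by (rule norm_add_sq_orthogonal)
    then have "(norm s)\<^sup>2 \<le> (norm v)\<^sup>2"
      by simp
    then show ?thesis
      unfolding nw ps by (intro mult_left_mono) auto
  qed
  finally show "norm (?B *v v) \<le> norm ?w * norm v"
    by (simp add: power_mult_distrib[symmetric] power2_le_iff_abs_le abs_mult)
qed

subsection \<open>Matrix polynomials\<close>

lemma mpoly_eval_vector_mult:
  assumes "P \<in> matrix_polys m"
  shows "mpoly_eval P z *v x = (\<Sum>j\<le>m. z ^ j *s (coeff P j *v x))"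
proof -
  have "mpoly_eval P z *v x = (\<Sum>j\<le>degree P. z ^ j *s (coeff P j *v x))"
    by (simp add: mpoly_eval_def cscale_vector_mult sum_matrix_vector_mult)
  also have "\<dots> = (\<Sum>j\<le>m. z ^ j *s (coeff P j *v x))"
    using assms by (intro sum.mono_neutral_left) (auto simp: matrix_polys_def coeff_eq_0)
  finally show ?thesis .
qed

lemma coeff_sum_monom:
  "coeff (\<Sum>j\<le>m. monom (f j) j) k = (if k \<le> m then f k else 0)"
  by (simp add: coeff_sum coeff_monom)

lemma sum_monom_in_matrix_polys: "(\<Sum>j\<le>m. monom (f j) j) \<in> matrix_polys m"
  unfolding matrix_polys_def by (auto intro!: degree_le simp: coeff_sum_monom)

lemma sum_monom_in_herm_polys:
  assumes "\<And>j. j \<le> m \<Longrightarrow> ctranspose (f j) = f j"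
  shows "(\<Sum>j\<le>m. monom (f j) j) \<in> herm_polys m"
  using assms by (auto simp: herm_polys_def sum_monom_in_matrix_polys coeff_sum_monom ctranspose_0)

lemma mpoly_eval_sum_monom:
  "mpoly_eval (\<Sum>j\<le>m. monom (f j) j) z *v x = (\<Sum>j\<le>m. z ^ j *s (f j *v x))"
  by (simp add: mpoly_eval_vector_mult[OF sum_monom_in_matrix_polys] coeff_sum_monom)

lemma mpoly_norm_sum_monom:
  "mpoly_norm m N (\<Sum>j\<le>m. monom (f j) j) = sqrt (\<Sum>j\<le>m. (N (f j))\<^sup>2)"
  by (simp add: mpoly_norm_def coeff_sum_monom)

lemma mpoly_eq_sum_monom_iff:
  assumes "Q \<in> matrix_polys m"
  shows "Q = (\<Sum>j\<le>m. monom (f j) j) \<longleftrightarrow> (\<forall>j\<le>m. coeff Q j = f j)"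
  using assms by (auto simp: poly_eq_iff coeff_sum_monom matrix_polys_def coeff_eq_0)

text \<open>The infimum is a minimum. An inequality for \<open>Q\<close> suffices, since the lower
  bound applies to \<open>Q\<close> itself.\<close>

lemma backward_error_eqI:
  assumes "Q \<in> S" "mpoly_eval P lam *v x + mpoly_eval Q lam *v x = 0"
    and "mpoly_norm m N Q \<le> v"
    and "\<And>R. R \<in> S \<Longrightarrow> mpoly_eval P lam *v x + mpoly_eval R lam *v x = 0 \<Longrightarrow> v \<le> mpoly_norm m N R"
  shows "backward_error m N S lam x P = v" and "mpoly_norm m N Q = v"
proof -
  show *: "mpoly_norm m N Q = v"
    using assms by (simp add: antisym)
  show "backward_error m N S lam x P = v"
    unfolding backward_error_def
    by (rule cInf_eq_minimum) (use * assms in auto)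
qed

section \<open>The unstructured backward error\<close>

definition power_norm_sq :: "nat \<Rightarrow> complex \<Rightarrow> real" where
  "power_norm_sq m lam = (\<Sum>j\<le>m. (cmod (lam ^ j))\<^sup>2)"

lemma power_norm_sq_pos: "power_norm_sq m lam > 0"
proof -
  have "(cmod (lam ^ 0))\<^sup>2 \<le> power_norm_sq m lam"
    unfolding power_norm_sq_def by (rule member_le_sum) auto
  then show ?thesis by simp
qed

lemma sum_power_cnj: "(\<Sum>j\<le>m. lam ^ j * cnj (lam ^ j)) = of_real (power_norm_sq m lam)"
  unfolding power_norm_sq_def of_real_sum complex_norm_square ..

lemma vnorm2_sq: "(vnorm2 v)\<^sup>2 = (\<Sum>j<dim_vec v. (norm (vec_index v j))\<^sup>2)"
  by (simp add: vnorm2_def sum_nonneg)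

lemma vnorm2_power_vec: "(vnorm2 (power_vec m lam))\<^sup>2 = power_norm_sq m lam"
  by (simp add: vnorm2_sq power_vec_def power_norm_sq_def lessThan_Suc_atMost del: sum.lessThan_Suc)

text \<open>The norm enters only through its lower bound at \<open>x\<close> and its upper bound on
  \<open>outer a x\<close>, so rank-one coefficients are optimal and one argument serves both
  norms.\<close>

lemma backward_error_unstructured:
  assumes x: "hdot x x = 1"
    and N: "\<And>A. norm (A *v x) \<le> N A" "\<And>a. N (outer a x) \<le> norm a"
  shows "backward_error m N (matrix_polys m) lam x P
    = norm (mpoly_eval P lam *v x) / sqrt (power_norm_sq m lam)"
proof -
  define r L where "r = - (mpoly_eval P lam *v x)" and "L = power_norm_sq m lam"
  define a where "a j = (cnj (lam ^ j) / of_real L) *s r" for j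
  have L: "L > 0" by (simp add: L_def power_norm_sq_pos)
  have N0: "N A \<ge> 0" for A
    using N(1) norm_ge_zero order_trans by blast
  let ?Q = "\<Sum>j\<le>m. monom (outer (a j) x) j"
  have "(\<Sum>j\<le>m. lam ^ j *s a j) = ((\<Sum>j\<le>m. lam ^ j * cnj (lam ^ j)) / of_real L) *s r"
    by (simp add: a_def sum_divide_distrib vec.scale_sum_left)
  then have a_sum: "(\<Sum>j\<le>m. lam ^ j *s a j) = r"
    using L by (simp add: sum_power_cnj L_def del: complex_cnj_power)
  have "(norm (a j))\<^sup>2 = (cmod (lam ^ j))\<^sup>2 * ((norm r)\<^sup>2 / L\<^sup>2)" for j
    by (simp add: a_def norm_smult_vec norm_divide norm_power power_mult_distrib power_divide)
  then have "(\<Sum>j\<le>m. (norm (a j))\<^sup>2) = L * ((norm r)\<^sup>2 / L\<^sup>2)"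
    by (simp only: L_def power_norm_sq_def sum_distrib_right)
  then have "(\<Sum>j\<le>m. (norm (a j))\<^sup>2) = (norm r)\<^sup>2 / L"
    using L by (simp add: power2_eq_square)
  moreover have "(\<Sum>j\<le>m. (N (outer (a j) x))\<^sup>2) \<le> (\<Sum>j\<le>m. (norm (a j))\<^sup>2)"
    by (intro sum_mono power_mono N N0)
  ultimately have "mpoly_norm m N ?Q \<le> sqrt ((norm r)\<^sup>2 / L)"
    by (simp add: mpoly_norm_sum_monom)
  then have Q: "mpoly_norm m N ?Q \<le> norm r / sqrt L"
    by (simp add: real_sqrt_divide)
  have "backward_error m N (matrix_polys m) lam x P = norm r / sqrt L"
  proof (rule backward_error_eqI[OF sum_monom_in_matrix_polys _ Q])
    show "mpoly_eval P lam *v x + mpoly_eval ?Q lam *v x = 0"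
      using a_sum by (simp add: mpoly_eval_sum_monom outer_vector_mult x r_def)
    fix R assume R: "R \<in> matrix_polys m" "mpoly_eval P lam *v x + mpoly_eval R lam *v x = 0"
    then have "r = (\<Sum>j\<le>m. lam ^ j *s (coeff R j *v x))"
      by (simp add: r_def mpoly_eval_vector_mult add_eq_0_iff)
    then have "norm r \<le> (\<Sum>j\<le>m. \<bar>cmod (lam ^ j)\<bar> * \<bar>N (coeff R j)\<bar>)"
      by (auto intro!: order_trans[OF norm_sum] sum_mono mult_left_mono N simp: norm_smult_vec N0)
    also have "\<dots> \<le> sqrt L * mpoly_norm m N R"
      using L2_set_mult_ineq[of "\<lambda>j. cmod (lam ^ j)" "\<lambda>j. N (coeff R j)" "{..m}"]
      by (simp add: L2_set_def mpoly_norm_def L_def power_norm_sq_def)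
    finally show "norm r / sqrt L \<le> mpoly_norm m N R"
      using L by (simp add: divide_le_eq mult.commute)
  qed
  then show ?thesis by (simp add: r_def L_def)
qed

subsection \<open>The optimal Hermitian perturbation\<close>

text \<open>
  The vector \<open>\<rho>\<close> is the minimum norm real solution of \<open>\<Sum>j. \<rho> j * lam ^ j = hdot x r\<close>: it lies in
  the row space of the real \<open>2 \<times> (m + 1)\<close> matrix of that equation.
\<close>

locale hermitian_residual =
  fixes m :: nat and lam :: complex and x r :: "complex ^ 'n" and \<rho> :: "nat \<Rightarrow> real" and s t :: real
  assumes unit: "hdot x x = 1"
    and rho_row_space: "\<And>j. j \<le> m \<Longrightarrow> \<rho> j = s * Re (lam ^ j) + t * Im (lam ^ j)"
    and rho_sum: "(\<Sum>j\<le>m. of_real (\<rho> j) * lam ^ j) = hdot x r"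
begin

abbreviation "L \<equiv> power_norm_sq m lam"

text \<open>This is \<open>P\<^sub>x r\<close>, the component of the residual orthogonal to
  \<open>x\<close>.\<close>

definition b :: "complex ^ 'n" where "b = r - hdot x r *s x"

definition w :: "nat \<Rightarrow> complex ^ 'n" where
  "w j = of_real (\<rho> j) *s x + (cnj (lam ^ j) / of_real L) *s b"

definition HF :: "nat \<Rightarrow> complex ^ 'n ^ 'n" where "HF j = hermitian_completion x (w j)"

text \<open>The correction annihilates \<open>x\<close>, so the images of \<open>x\<close> are those
  under \<open>HF\<close>. For \<open>b = 0\<close> it is 0.\<close>

definition H2 :: "nat \<Rightarrow> complex ^ 'n ^ 'n" where
  "H2 j = HF j - (\<rho> j / (norm b)\<^sup>2) *\<^sub>R outer b b"

lemma hdot_x_b: "hdot x b = 0"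
  by (simp add: b_def hdot_simps unit)

lemma hdot_b_x: "hdot b x = 0"
  by (metis hdot_x_b cnj_hdot complex_cnj_zero)

lemma norm_x: "norm x = 1"
  using unit by (rule hdot_self_1D)

lemma norm_b: "(norm b)\<^sup>2 = (norm r)\<^sup>2 - (cmod (hdot x r))\<^sup>2"
proof -
  have "r = hdot x r *s x + 1 *s b"
    by (simp add: b_def)
  then have "(norm r)\<^sup>2 = (cmod (hdot x r) * norm x)\<^sup>2 + (cmod 1 * norm b)\<^sup>2"
    by (metis norm_combination_sq_orthogonal[OF hdot_x_b])
  then show ?thesis by (simp add: norm_x)
qed

lemma hdot_x_w: "hdot x (w j) = of_real (\<rho> j)"
  by (simp add: w_def hdot_simps unit hdot_x_b)

lemma HF_x: "HF j *v x = w j"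
  unfolding HF_def by (rule hermitian_completion_vector_mult[OF unit]) (simp add: hdot_x_w)

lemma H2_x: "H2 j *v x = w j"
  by (simp add: H2_def matrix_vector_mult_diff_rdistrib HF_x cscale_vector_mult outer_vector_mult
      hdot_b_x flip: cscale_of_real)

lemma HF_hermitian: "ctranspose (HF j) = HF j"
  by (simp add: HF_def ctranspose_hermitian_completion)

lemma H2_hermitian: "ctranspose (H2 j) = H2 j"
  by (simp add: H2_def HF_hermitian ctranspose_diff ctranspose_scaleR ctranspose_outer)

lemma sum_w: "(\<Sum>j\<le>m. lam ^ j *s w j) = r"
proof -
  have "(\<Sum>j\<le>m. lam ^ j * (cnj (lam ^ j) / of_real L)) = 1"
    using power_norm_sq_pos[of m lam] by (simp add: sum_power_cnj flip: sum_divide_distrib del: complex_cnj_power)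
  moreover have "(\<Sum>j\<le>m. lam ^ j *s w j) = (\<Sum>j\<le>m. of_real (\<rho> j) * lam ^ j) *s x
      + (\<Sum>j\<le>m. lam ^ j * (cnj (lam ^ j) / of_real L)) *s b"
    by (simp add: w_def sum.distrib vec.scale_right_distrib vec.scale_sum_left mult.commute)
  ultimately show ?thesis
    by (simp add: rho_sum b_def)
qed

lemma norm_w: "(norm (w j))\<^sup>2 = (\<rho> j)\<^sup>2 + (cmod (lam ^ j))\<^sup>2 * ((norm b)\<^sup>2 / L\<^sup>2)"
  by (simp add: w_def norm_combination_sq_orthogonal[OF hdot_x_b] norm_x norm_divide norm_power
      power_mult_distrib power_divide)

lemma sum_norm_w: "(\<Sum>j\<le>m. (norm (w j))\<^sup>2) = (\<Sum>j\<le>m. (\<rho> j)\<^sup>2) + (norm b)\<^sup>2 / L"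
proof -
  have "(\<Sum>j\<le>m. (norm (w j))\<^sup>2) = (\<Sum>j\<le>m. (\<rho> j)\<^sup>2) + L * ((norm b)\<^sup>2 / L\<^sup>2)"
    unfolding norm_w sum.distrib power_norm_sq_def[of m] sum_distrib_right ..
  then show ?thesis
    using power_norm_sq_pos[of m lam] by (simp add: power2_eq_square)
qed

lemma sum_norm_HF: "(\<Sum>j\<le>m. (norm (HF j))\<^sup>2) = (\<Sum>j\<le>m. (\<rho> j)\<^sup>2) + 2 * (norm b)\<^sup>2 / L"
proof -
  have "(norm (HF j))\<^sup>2 = 2 * (norm (w j))\<^sup>2 - (\<rho> j)\<^sup>2" for j
    unfolding HF_def by (subst norm_hermitian_completion[OF unit]) (simp_all add: hdot_x_w)
  then show ?thesis
    by (simp add: sum_subtractf sum_norm_w flip: sum_distrib_left)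
qed

lemma spectral_norm_H2: "spectral_norm (H2 j) \<le> norm (w j)"
  unfolding H2_def HF_def w_def by (rule spectral_norm_completion_le[OF unit hdot_x_b])

text \<open>Two solutions of the constraints differ by a solution \<open>d\<close> of the
  homogeneous ones. Both optimal choices lie in row spaces, hence are orthogonal to every such
  \<open>d\<close>.\<close>

lemma orthogonal_to_homogeneous:
  assumes d: "(\<Sum>j\<le>m. lam ^ j *s d j) = 0" and real: "\<And>j. j \<le> m \<Longrightarrow> Im (hdot x (d j)) = 0"
  shows "(\<Sum>j\<le>m. \<rho> j * Re (hdot x (d j))) = 0" and "(\<Sum>j\<le>m. Re (hdot (w j) (d j))) = 0"
proof -
  have *: "(\<Sum>j\<le>m. lam ^ j * hdot y (d j)) = 0" for y
    using arg_cong[OF d, of "hdot y"] by (simp add: hdot_sum_right hdot_smult_right hdot_zero_right)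
  \<comment> \<open>As \<open>hdot x (d j)\<close> is real, the complex equation splits into
    orthogonality to the real and the imaginary row.\<close>
  have "(\<Sum>j\<le>m. Re (lam ^ j) * Re (hdot x (d j))) = 0" "(\<Sum>j\<le>m. Im (lam ^ j) * Re (hdot x (d j))) = 0"
    using arg_cong[OF *[of x], of Re] arg_cong[OF *[of x], of Im] real by simp_all
  moreover have "(\<Sum>j\<le>m. \<rho> j * Re (hdot x (d j)))
      = s * (\<Sum>j\<le>m. Re (lam ^ j) * Re (hdot x (d j))) + t * (\<Sum>j\<le>m. Im (lam ^ j) * Re (hdot x (d j)))"
    by (simp add: rho_row_space algebra_simps sum.distrib sum_distrib_left)
  ultimately show rho: "(\<Sum>j\<le>m. \<rho> j * Re (hdot x (d j))) = 0"
    by simp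
  \<comment> \<open>Conjugation in the first argument turns the weight \<open>cnj (lam ^ j)\<close>
    of \<open>b\<close> into \<open>lam ^ j\<close>, so the homogeneous equation applies.\<close>
  have "(\<Sum>j\<le>m. hdot (w j) (d j))
      = (\<Sum>j\<le>m. of_real (\<rho> j) * hdot x (d j)) + (\<Sum>j\<le>m. lam ^ j * hdot b (d j)) / of_real L"
    by (simp add: w_def hdot_simps sum.distrib sum_divide_distrib)
  then have "(\<Sum>j\<le>m. hdot (w j) (d j)) = (\<Sum>j\<le>m. of_real (\<rho> j) * hdot x (d j))"
    using *[of b] by simp
  then have "Re (\<Sum>j\<le>m. hdot (w j) (d j)) = (\<Sum>j\<le>m. \<rho> j * Re (hdot x (d j)))"
    by simp
  then show "(\<Sum>j\<le>m. Re (hdot (w j) (d j))) = 0"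
    using rho by simp
qed

section \<open>Comparison with an arbitrary Hermitian solution\<close>

context
  fixes A :: "nat \<Rightarrow> complex ^ 'n ^ 'n"
  assumes A: "\<And>j. j \<le> m \<Longrightarrow> ctranspose (A j) = A j" and A_sum: "(\<Sum>j\<le>m. lam ^ j *s (A j *v x)) = r"
begin

lemma difference_homogeneous:
  shows "(\<Sum>j\<le>m. lam ^ j *s ((A j - HF j) *v x)) = 0"
    and "j \<le> m \<Longrightarrow> Im (hdot x ((A j - HF j) *v x)) = 0"
proof -
  show "(\<Sum>j\<le>m. lam ^ j *s ((A j - HF j) *v x)) = 0"
    by (simp add: matrix_vector_mult_diff_rdistrib HF_x vec.scale_right_diff_distrib sum_subtractf
        A_sum sum_w)
  show "Im (hdot x ((A j - HF j) *v x)) = 0" if "j \<le> m"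
    using hdot_hermitian_real[of "A j - HF j" x] that A HF_hermitian
    by (metis Im_complex_of_real ctranspose_diff)
qed

lemmas orthogonal_difference = orthogonal_to_homogeneous[OF difference_homogeneous]

text \<open>Pythagoras for the whole family: the cross terms cancel after summation over
  \<open>j\<close>, not one by one. The excess is kept because its vanishing yields
  uniqueness.\<close>

lemma sum_norm_frobenius:
  "(\<Sum>j\<le>m. (norm (A j))\<^sup>2) = (\<Sum>j\<le>m. (norm (HF j))\<^sup>2) + (\<Sum>j\<le>m. (norm (A j - HF j))\<^sup>2)"
proof -
  have "(norm (A j))\<^sup>2 = (norm (HF j))\<^sup>2 + (norm (A j - HF j))\<^sup>2
      + (4 * Re (hdot (w j) ((A j - HF j) *v x)) - 2 * (\<rho> j * Re (hdot x ((A j - HF j) *v x))))"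
    if "j \<le> m" for j
  proof -
    have "(norm (HF j + (A j - HF j)))\<^sup>2
        = (norm (HF j))\<^sup>2 + (norm (A j - HF j))\<^sup>2 + 2 * inner (HF j) (A j - HF j)"
      by (simp only: power2_norm_eq_inner inner_add_left inner_add_right)
        (simp add: inner_commute)
    moreover have "inner (HF j) (A j - HF j)
        = 2 * Re (hdot (w j) ((A j - HF j) *v x)) - \<rho> j * Re (hdot x ((A j - HF j) *v x))"
      unfolding HF_def[of j]
      by (subst inner_hermitian_completion)
        (simp_all add: ctranspose_diff A that ctranspose_hermitian_completion hdot_x_w)
    ultimately show ?thesis by simp
  qed
  then show ?thesis
    by (simp add: sum.distrib sum_subtractf orthogonal_difference flip: sum_distrib_left)
qed

text \<open>Pythagoras again, now for the images of \<open>x\<close>, which bound the spectral norms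
  from below.\<close>

lemma sum_norm_residual: "(\<Sum>j\<le>m. (norm (w j))\<^sup>2) \<le> (\<Sum>j\<le>m. (norm (A j *v x))\<^sup>2)"
proof -
  have "(norm (A j *v x))\<^sup>2 = (norm (w j))\<^sup>2 + (norm ((A j - HF j) *v x))\<^sup>2
      + 2 * Re (hdot (w j) ((A j - HF j) *v x))" for j
  proof -
    have "A j *v x = w j + (A j - HF j) *v x"
      by (simp add: matrix_vector_mult_diff_rdistrib HF_x)
    then show ?thesis
      by (simp add: power2_norm_eq_inner inner_add_left inner_add_right inner_commute Re_hdot)
  qed
  then show ?thesis
    by (simp add: sum.distrib orthogonal_difference sum_nonneg flip: sum_distrib_left)
qed

end

section \<open>Closed forms of the optimal coefficients\<close>

lemma HF_eq:
  "HF j = of_real (\<rho> j) *\<^sub>C outer x x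
    + (1 / of_real L) *\<^sub>C (cnj (lam ^ j) *\<^sub>C outer b x + lam ^ j *\<^sub>C outer x b)"
  unfolding HF_def hermitian_completion_def hdot_x_w Re_complex_of_real cscale_of_real[symmetric]
  by (simp add: w_def Finite_Cartesian_Product.vec_eq_iff outer_def cscale_def map_matrix_def
      algebra_simps add_divide_distrib)

text \<open>For real \<open>lam\<close> the imaginary row is 0, so \<open>\<rho>\<close> is
  \<open>s\<close> times the powers, and \<open>rho_sum\<close> gives
  \<open>s * L = hdot x r\<close>.\<close>

lemma rho_real:
  assumes "lam \<in> \<real>" "j \<le> m"
  shows "of_real (\<rho> j) = lam ^ j * hdot x r / of_real L"
proof -
  obtain l where l: "lam = of_real l"
    using assms(1) by (elim Reals_cases)
  have rho: "of_real (\<rho> i) = of_real s * lam ^ i" if "i \<le> m" for i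
    using rho_row_space[OF that] by (simp add: l flip: of_real_power)
  have "hdot x r = (\<Sum>i\<le>m. of_real s * (lam ^ i * cnj (lam ^ i)))"
    unfolding rho_sum[symmetric] by (rule sum.cong) (simp_all add: rho, simp add: l)
  also have "\<dots> = of_real s * of_real L"
    by (simp only: sum_power_cnj flip: sum_distrib_left)
  finally show ?thesis
    using power_norm_sq_pos[of m lam] by (simp add: rho assms(2))
qed

text \<open>Up to the factor \<open>lam ^ j / L\<close>, expanding \<open>b\<close> in
  \<open>HF_eq\<close> subtracts \<open>hdot x r\<close> twice from the coefficient of
  \<open>outer x x\<close>, and \<open>\<rho> j\<close> adds it once.\<close>

lemma HF_real:
  assumes "lam \<in> \<real>" "Im (hdot x r) = 0" "j \<le> m"
  shows "HF j = (lam ^ j / of_real L) *\<^sub>C (outer x r + outer r x - hdot r x *\<^sub>C outer x x)"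
proof -
  have "cnj (lam ^ j) = lam ^ j"
    using assms(1) by (auto elim!: Reals_cases)
  moreover have c: "cnj (hdot x r) = hdot x r"
    using assms(2) by (simp add: complex_eq_iff)
  moreover have "hdot r x = hdot x r"
    using c by (simp add: cnj_hdot)
  ultimately show ?thesis
    unfolding HF_eq rho_real[OF assms(1,3)]
    by (simp add: b_def Finite_Cartesian_Product.vec_eq_iff outer_def cscale_def map_matrix_def
        algebra_simps add_divide_distrib diff_divide_distrib del: complex_cnj_power)
qed

lemma sum_rho_real:
  assumes "lam \<in> \<real>"
  shows "(\<Sum>j\<le>m. (\<rho> j)\<^sup>2) = (cmod (hdot x r))\<^sup>2 / L"
proof -
  have "(\<rho> j)\<^sup>2 = (cmod (lam ^ j))\<^sup>2 * ((cmod (hdot x r))\<^sup>2 / L\<^sup>2)" if "j \<le> m" for j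
    using arg_cong[OF rho_real[OF assms that], of "\<lambda>z. (cmod z)\<^sup>2"]
    by (simp add: norm_mult norm_divide power_mult_distrib power_divide)
  then have "(\<Sum>j\<le>m. (\<rho> j)\<^sup>2) = L * ((cmod (hdot x r))\<^sup>2 / L\<^sup>2)"
    by (simp add: power_norm_sq_def sum_distrib_right sum_divide_distrib)
  then show ?thesis
    using power_norm_sq_pos[of m lam] by (simp add: power2_eq_square)
qed

section \<open>Passage from coefficient families to matrix polynomials\<close>

context
  fixes P :: "(complex ^ 'n ^ 'n) poly"
  assumes r: "r = - (mpoly_eval P lam *v x)"
begin

lemma residual_iff:
  assumes "R \<in> matrix_polys m"
  shows "mpoly_eval P lam *v x + mpoly_eval R lam *v x = 0
    \<longleftrightarrow> (\<Sum>j\<le>m. lam ^ j *s (coeff R j *v x)) = r"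
  unfolding r mpoly_eval_vector_mult[OF assms, symmetric] by (auto simp: add_eq_0_iff)

lemma HF_residual: "mpoly_eval P lam *v x + mpoly_eval (\<Sum>j\<le>m. monom (HF j) j) lam *v x = 0"
  by (simp add: mpoly_eval_sum_monom HF_x sum_w) (simp add: r)

lemma H2_residual: "mpoly_eval P lam *v x + mpoly_eval (\<Sum>j\<le>m. monom (H2 j) j) lam *v x = 0"
  by (simp add: mpoly_eval_sum_monom H2_x sum_w) (simp add: r)

lemma herm_frobenius:
  assumes R: "R \<in> herm_polys m" "mpoly_eval P lam *v x + mpoly_eval R lam *v x = 0"
  shows "(\<Sum>j\<le>m. (norm (coeff R j))\<^sup>2)
    = (\<Sum>j\<le>m. (norm (HF j))\<^sup>2) + (\<Sum>j\<le>m. (norm (coeff R j - HF j))\<^sup>2)"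
  by (rule sum_norm_frobenius) (use R residual_iff in \<open>auto simp: herm_polys_def\<close>)

lemma backward_error_herm_frobenius:
  "backward_error m norm (herm_polys m) lam x P = sqrt (\<Sum>j\<le>m. (norm (HF j))\<^sup>2)"
proof (rule backward_error_eqI(1)[OF sum_monom_in_herm_polys HF_residual])
  fix R assume "R \<in> herm_polys m" "mpoly_eval P lam *v x + mpoly_eval R lam *v x = 0"
  from herm_frobenius[OF this] show "sqrt (\<Sum>j\<le>m. (norm (HF j))\<^sup>2) \<le> mpoly_norm m norm R"
    by (simp add: mpoly_norm_def sum_nonneg)
qed (simp_all add: HF_hermitian mpoly_norm_sum_monom)

text \<open>By \<open>herm_frobenius\<close> a minimizer has excess 0, which forces every
  coefficient to equal \<open>HF j\<close>.\<close>

lemma optimal_herm_frobenius_iff: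
  "R \<in> herm_polys m \<and> mpoly_eval P lam *v x + mpoly_eval R lam *v x = 0
     \<and> mpoly_norm m norm R = backward_error m norm (herm_polys m) lam x P
   \<longleftrightarrow> R = (\<Sum>j\<le>m. monom (HF j) j)"
proof
  assume R: "R \<in> herm_polys m \<and> mpoly_eval P lam *v x + mpoly_eval R lam *v x = 0
     \<and> mpoly_norm m norm R = backward_error m norm (herm_polys m) lam x P"
  then have "(\<Sum>j\<le>m. (norm (coeff R j))\<^sup>2) = (\<Sum>j\<le>m. (norm (HF j))\<^sup>2)"
    by (simp add: mpoly_norm_def backward_error_herm_frobenius)
  then have "(\<Sum>j\<le>m. (norm (coeff R j - HF j))\<^sup>2) = 0"
    using herm_frobenius R by auto
  then have "\<forall>j\<le>m. coeff R j = HF j"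
    by (subst (asm) sum_nonneg_eq_0_iff) auto
  then show "R = (\<Sum>j\<le>m. monom (HF j) j)"
    using R by (subst mpoly_eq_sum_monom_iff) (auto simp: herm_polys_def)
next
  assume "R = (\<Sum>j\<le>m. monom (HF j) j)"
  then show "R \<in> herm_polys m \<and> mpoly_eval P lam *v x + mpoly_eval R lam *v x = 0
     \<and> mpoly_norm m norm R = backward_error m norm (herm_polys m) lam x P"
    by (simp add: sum_monom_in_herm_polys HF_hermitian HF_residual mpoly_norm_sum_monom
        backward_error_herm_frobenius)
qed

lemma backward_error_herm_spectral:
  shows "backward_error m spectral_norm (herm_polys m) lam x P = sqrt (\<Sum>j\<le>m. (norm (w j))\<^sup>2)" (is ?value)
    and "mpoly_norm m spectral_norm (\<Sum>j\<le>m. monom (H2 j) j)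
      = backward_error m spectral_norm (herm_polys m) lam x P" (is ?attained)
proof -
  have ge: "norm (A *v x) \<le> spectral_norm A" for A
    using spectral_norm_ge[of A x] by (simp add: norm_x)
  then have nonneg: "spectral_norm A \<ge> 0" for A :: "complex ^ 'n ^ 'n"
    using norm_ge_zero order_trans by blast
  have herm: "(\<Sum>j\<le>m. monom (H2 j) j) \<in> herm_polys m"
    by (simp add: sum_monom_in_herm_polys H2_hermitian)
  have upper: "mpoly_norm m spectral_norm (\<Sum>j\<le>m. monom (H2 j) j) \<le> sqrt (\<Sum>j\<le>m. (norm (w j))\<^sup>2)"
    by (auto simp: mpoly_norm_sum_monom intro!: sum_mono power_mono spectral_norm_H2 nonneg)
  have lower: "sqrt (\<Sum>j\<le>m. (norm (w j))\<^sup>2) \<le> mpoly_norm m spectral_norm R"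
    if R: "R \<in> herm_polys m" "mpoly_eval P lam *v x + mpoly_eval R lam *v x = 0" for R
  proof -
    have "(\<Sum>j\<le>m. (norm (w j))\<^sup>2) \<le> (\<Sum>j\<le>m. (norm (coeff R j *v x))\<^sup>2)"
      by (rule sum_norm_residual) (use R residual_iff in \<open>auto simp: herm_polys_def\<close>)
    also have "\<dots> \<le> (\<Sum>j\<le>m. (spectral_norm (coeff R j))\<^sup>2)"
      by (intro sum_mono power_mono ge) simp
    finally show ?thesis
      by (simp add: mpoly_norm_def)
  qed
  note * = backward_error_eqI[OF herm H2_residual upper lower]
  show ?value ?attained
    using * by simp_all
qed

end

end

subsection \<open>The pseudo-inverse of a real matrix with two rows\<close>

text \<open>The sums say that \<open>A * X\<close> is diagonal with entries 1 and \<open>e\<close>;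
  \<open>sym\<close> is the symmetry of \<open>X * A\<close>. The parameter \<open>e\<close> is 1
  for independent rows and 0 for a vanishing second row.\<close>

lemma is_pinv_two_rows:
  fixes u v f g :: "nat \<Rightarrow> real" and k :: nat and e :: real
  defines "A \<equiv> Matrix.mat 2 k (\<lambda>(i, j). if i = 0 then u j else v j)"
    and "X \<equiv> Matrix.mat k 2 (\<lambda>(j, i). if i = 0 then f j else g j)"
  assumes uf: "(\<Sum>j<k. u j * f j) = 1" and ug: "(\<Sum>j<k. u j * g j) = 0"
    and vf: "(\<Sum>j<k. v j * f j) = 0" and vg: "(\<Sum>j<k. v j * g j) = e"
    and ev: "\<And>j. j < k \<Longrightarrow> e * v j = v j" and eg: "\<And>j. j < k \<Longrightarrow> e * g j = g j"
    and sym: "\<And>i j. f i * u j + g i * v j = f j * u i + g j * v i"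
  shows "is_pinv A X"
proof -
  define E :: "real Matrix.mat" where
    "E = Matrix.mat 2 2 (\<lambda>(i, j). if i = j then if i = 0 then 1 else e else 0)"
  have A: "A \<in> carrier_mat 2 k" and X: "X \<in> carrier_mat k 2"
    by (simp_all add: A_def X_def)
  have AX: "A * X = E"
  proof (rule eq_matI)
    fix i j assume "i < dim_row E" "j < dim_col E"
    then have "i < 2" "j < 2" by (simp_all add: E_def)
    then show "(A * X) $$ (i, j) = E $$ (i, j)"
      by (auto simp: A_def X_def E_def scalar_prod_def less_2_cases_iff uf ug vf vg
          simp flip: lessThan_atLeast0)
  qed (simp_all add: A_def X_def E_def)
  have EA: "E * A = A"
    by (rule eq_matI) (auto simp: A_def E_def scalar_prod_def less_2_cases_iff ev numeral_2_eq_2)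
  have XE: "X * E = X"
    by (rule eq_matI) (auto simp: X_def E_def scalar_prod_def less_2_cases_iff eg numeral_2_eq_2 mult.commute)
  have "X * A * X = X * (A * X)"
    using A X by (rule assoc_mult_mat[rotated]) (use X in auto)
  then have "X * A * X = X" by (simp add: AX XE)
  moreover have "transpose_mat E = E"
    by (rule eq_matI) (auto simp: E_def)
  moreover have "transpose_mat (X * A) = X * A"
    by (rule eq_matI) (auto simp: A_def X_def scalar_prod_def numeral_2_eq_2 sym)
  ultimately show ?thesis
    using A X by (simp add: is_pinv_def AX EA)
qed

lemma pinv_two_rows_mult_vec:
  fixes u v f g :: "nat \<Rightarrow> real"
  assumes "(\<Sum>j<k. u j * f j) = 1" "(\<Sum>j<k. u j * g j) = 0"
    and "(\<Sum>j<k. v j * f j) = 0" "(\<Sum>j<k. v j * g j) = e"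
    and "\<And>j. j < k \<Longrightarrow> e * v j = v j" "\<And>j. j < k \<Longrightarrow> e * g j = g j"
    and "\<And>i j. f i * u j + g i * v j = f j * u i + g j * v i"
  shows "pinv (mat_of_rows k [Matrix.vec k u, Matrix.vec k v]) *\<^sub>v vec_of_list [p, q]
    = Matrix.vec k (\<lambda>j. f j * p + g j * q)"
proof -
  have "mat_of_rows k [Matrix.vec k u, Matrix.vec k v]
      = Matrix.mat 2 k (\<lambda>(i, j). if i = 0 then u j else v j)"
    by (rule eq_matI) (auto simp: mat_of_rows_def less_2_cases_iff)
  then have "pinv (mat_of_rows k [Matrix.vec k u, Matrix.vec k v])
      = Matrix.mat k 2 (\<lambda>(j, i). if i = 0 then f j else g j)"
    using pinv_eqI[OF is_pinv_two_rows[OF assms]] by simp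
  then show ?thesis
    by (auto intro!: eq_vecI simp: scalar_prod_def numeral_2_eq_2)
qed

text \<open>The right-hand side \<open>c\<close> has to lie in the column space of the matrix.\<close>

lemma pinv_power_vec:
  fixes lam c :: complex
  assumes c: "lam \<in> \<real> \<Longrightarrow> Im c = 0" and m: "m \<ge> 1"
  obtains s t \<rho> where
    "pinv (mat_of_rows (m + 1) [map_vec Re (power_vec m lam), map_vec Im (power_vec m lam)])
       *\<^sub>v vec_of_list [Re c, Im c] = Matrix.vec (m + 1) \<rho>"
    and "\<And>j. \<rho> j = s * Re (lam ^ j) + t * Im (lam ^ j)"
    and "(\<Sum>j\<le>m. of_real (\<rho> j) * lam ^ j) = c"
proof -
  define u v where "u j = Re (lam ^ j)" and "v j = Im (lam ^ j)" for j
  define uu uv vv where "uu = (\<Sum>j<m+1. u j * u j)" and "uv = (\<Sum>j<m+1. u j * v j)"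
    and "vv = (\<Sum>j<m+1. v j * v j)"
  have vu: "(\<Sum>j<m+1. v j * u j) = uv"
    by (simp add: uv_def mult.commute)
  have rows: "map_vec Re (power_vec m lam) = Matrix.vec (m + 1) u"
    "map_vec Im (power_vec m lam) = Matrix.vec (m + 1) v"
    by (auto simp: power_vec_def u_def v_def)
  \<comment> \<open>One statement for both ranks; its last conjunct says that the right-hand side
    lies in the column space.\<close>
  have "\<exists>s t f g e. (\<Sum>j<m+1. u j * f j) = 1 \<and> (\<Sum>j<m+1. u j * g j) = 0
    \<and> (\<Sum>j<m+1. v j * f j) = 0 \<and> (\<Sum>j<m+1. v j * g j) = e
    \<and> (\<forall>j. e * v j = v j) \<and> (\<forall>j. e * g j = g j)
    \<and> (\<forall>i j. f i * u j + g i * v j = f j * u i + g j * v i)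
    \<and> (\<forall>j. f j * Re c + g j * Im c = s * u j + t * v j) \<and> e * Im c = Im c"
  proof (cases "lam \<in> \<real>")
    case True
    then have v: "v j = 0" for j
      by (auto simp: v_def elim!: Reals_cases simp flip: of_real_power)
    have "(u 0)\<^sup>2 \<le> (\<Sum>j<m+1. (u j)\<^sup>2)"
      by (rule member_le_sum) auto
    then have "uu > 0"
      by (simp add: uu_def u_def power2_eq_square)
    \<comment> \<open>Only the row \<open>u\<close> is nonzero: its pseudo-inverse is
      \<open>u / uu\<close>, the second column is 0, and \<open>e = 0\<close>.\<close>
    then show ?thesis
      using c[OF True]
      by (intro exI[of _ "Re c / uu"] exI[of _ 0] exI[of _ "\<lambda>j. u j / uu"] exI[of _ "\<lambda>_. 0"])
        (simp add: v uu_def flip: sum_divide_distrib)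
  next
    case False
    define d where "d = uu * vv - uv * uv"
    \<comment> \<open>Since \<open>m \<ge> 1\<close>, the index 1 is in range, and
      \<open>v 1 = Im lam\<close> is nonzero.\<close>
    have "(v 1)\<^sup>2 \<le> (\<Sum>j<m+1. (v j)\<^sup>2)"
      by (rule member_le_sum) (use m in auto)
    moreover have "v 1 \<noteq> 0"
      using False by (simp add: v_def complex_is_Real_iff)
    ultimately have vv: "vv > 0"
      unfolding vv_def power2_eq_square[symmetric] by (meson order_less_le_trans zero_less_power2)
    \<comment> \<open>\<open>d\<close> is the Gram determinant of the rows. If it were 0, all
      \<open>vv * u j - uv * v j\<close> would vanish, but the entry at 0 is
      \<open>vv\<close>.\<close>
    have "d \<noteq> 0"
    proof
      assume "d = 0"
      have "(vv * u j - uv * v j)\<^sup>2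
          = vv * vv * (u j * u j) - 2 * vv * uv * (u j * v j) + uv * uv * (v j * v j)" for j
        by (simp add: power2_eq_square algebra_simps)
      then have "(\<Sum>j<m+1. (vv * u j - uv * v j)\<^sup>2) = vv * vv * uu - 2 * vv * uv * uv + uv * uv * vv"
        by (simp only: sum.distrib sum_subtractf sum_distrib_left[symmetric]
            uu_def[symmetric] uv_def[symmetric] vv_def[symmetric])
      also have "\<dots> = vv * d"
        by (simp add: d_def algebra_simps)
      finally have "(\<Sum>j<m+1. (vv * u j - uv * v j)\<^sup>2) = 0"
        using \<open>d = 0\<close> by simp
      then have "(vv * u 0 - uv * v 0)\<^sup>2 = 0"
        by (subst (asm) sum_nonneg_eq_0_iff) auto
      then show False
        using vv by (simp add: u_def v_def)
    qed
    \<comment> \<open>The columns of \<open>A\<^sup>T (A A\<^sup>T)\<^sup>-\<^sup>1\<close>, with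
      the inverse of the Gram matrix written out by cofactors.\<close>
    define f g where "f j = (vv * u j - uv * v j) / d" and "g j = (uu * v j - uv * u j) / d" for j
    have sums: "(\<Sum>j<m+1. h j * f j) = (vv * (\<Sum>j<m+1. h j * u j) - uv * (\<Sum>j<m+1. h j * v j)) / d"
      "(\<Sum>j<m+1. h j * g j) = (uu * (\<Sum>j<m+1. h j * v j) - uv * (\<Sum>j<m+1. h j * u j)) / d" for h
      by (simp_all add: f_def g_def sum_distrib_left right_diff_distrib sum_subtractf diff_divide_distrib
          sum_divide_distrib mult_ac del: sum.lessThan_Suc)
    have "(\<Sum>j<m+1. u j * f j) = 1" "(\<Sum>j<m+1. u j * g j) = 0"
      "(\<Sum>j<m+1. v j * f j) = 0" "(\<Sum>j<m+1. v j * g j) = 1"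
      using \<open>d \<noteq> 0\<close>
      unfolding sums vu uu_def[symmetric] uv_def[symmetric] vv_def[symmetric]
      by (simp_all add: d_def algebra_simps)
    moreover have "f i * u j + g i * v j = f j * u i + g j * v i" for i j
      by (simp add: f_def g_def diff_divide_distrib algebra_simps)
    moreover have "f j * Re c + g j * Im c
        = (vv * Re c - uv * Im c) / d * u j + (uu * Im c - uv * Re c) / d * v j" for j
      using \<open>d \<noteq> 0\<close> by (simp add: f_def g_def field_simps)
    ultimately show ?thesis
      by (intro exI[of _ "(vv * Re c - uv * Im c) / d"] exI[of _ "(uu * Im c - uv * Re c) / d"]
          exI[of _ f] exI[of _ g] exI[of _ 1]) simp
  qed
  then obtain s t f g e where fg: "(\<Sum>j<m+1. u j * f j) = 1" "(\<Sum>j<m+1. u j * g j) = 0"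
      "(\<Sum>j<m+1. v j * f j) = 0" "(\<Sum>j<m+1. v j * g j) = e"
      "\<And>j. e * v j = v j" "\<And>j. e * g j = g j"
      "\<And>i j. f i * u j + g i * v j = f j * u i + g j * v i"
    and st: "\<And>j. f j * Re c + g j * Im c = s * u j + t * v j" and e: "e * Im c = Im c"
    by blast
  define \<rho> where "\<rho> j = f j * Re c + g j * Im c" for j
  show ?thesis
  proof
    show "pinv (mat_of_rows (m + 1) [map_vec Re (power_vec m lam), map_vec Im (power_vec m lam)])
       *\<^sub>v vec_of_list [Re c, Im c] = Matrix.vec (m + 1) \<rho>"
      unfolding rows \<rho>_def by (rule pinv_two_rows_mult_vec[OF fg])
    show "\<rho> j = s * Re (lam ^ j) + t * Im (lam ^ j)" for j
      by (simp add: \<rho>_def st u_def v_def)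
    have *: "(\<Sum>j\<le>m. h j * \<rho> j) = (\<Sum>j<m+1. h j * f j) * Re c + (\<Sum>j<m+1. h j * g j) * Im c" for h
      unfolding sum_distrib_right sum.distrib[symmetric]
      by (simp add: \<rho>_def algebra_simps lessThan_Suc_atMost del: sum.lessThan_Suc)
    show "(\<Sum>j\<le>m. of_real (\<rho> j) * lam ^ j) = c"
      using *[of u] *[of v] unfolding fg
      by (simp add: complex_eq_iff u_def v_def mult.commute e)
  qed
qed

text \<open>A real combination of values of Hermitian forms is real. For real \<open>lam\<close>
  this puts \<open>hdot x r\<close> into the column space required by
  \<open>pinv_power_vec\<close>.\<close>

lemma hdot_hermitian_residual_real:
  assumes P: "P \<in> herm_polys m" and lam: "lam \<in> \<real>"
  shows "Im (hdot x (mpoly_eval P lam *v x)) = 0"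
proof -
  obtain l where l: "lam = of_real l"
    using lam by (elim Reals_cases)
  have "Im (hdot x (coeff P j *v x)) = 0" for j
    using P hdot_hermitian_real[of "coeff P j" x]
    by (metis (mono_tags, lifting) Im_complex_of_real herm_polys_def mem_Collect_eq)
  moreover have "P \<in> matrix_polys m"
    using P by (simp add: herm_polys_def)
  ultimately show ?thesis
    by (simp add: mpoly_eval_vector_mult[of P m] hdot_sum_right hdot_smult_right l flip: of_real_power)
qed

subsection \<open>The structured backward errors\<close>

theorem theorem3p12:
  fixes m :: nat and P :: "(complex ^ 'n ^ 'n) poly" and lam :: complex and x r :: "complex ^ 'n"
    and Px :: "complex ^ 'n ^ 'n" and \<Lambda> :: "complex Matrix.vec" and rhat :: "real Matrix.vec"
    and \<Delta>AF \<Delta>A2 :: "nat \<Rightarrow> complex ^ 'n ^ 'n" and \<Delta>PF \<Delta>P2 :: "(complex ^ 'n ^ 'n) poly"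
  assumes "m \<ge> 1"
    and "P \<in> herm_polys m"
    and "regular_mpoly P"
    and "hdot x x = 1"
    and "r = - (mpoly_eval P lam *v x)"
    and "Px = mat 1 - outer x x"
    and "\<Lambda> = power_vec m lam"
    and "rhat = pinv (mat_of_rows (m + 1) [map_vec Re \<Lambda>, map_vec Im \<Lambda>])
                  *\<^sub>v vec_of_list [Re (hdot x r), Im (hdot x r)]"
    and "\<And>j. \<Delta>AF j =
          (if lam \<in> \<real> then
             (lam ^ j / of_real ((vnorm2 \<Lambda>)\<^sup>2)) *\<^sub>C (outer x r + outer r x - hdot r x *\<^sub>C outer x x)
           else
             of_real (vec_index rhat j) *\<^sub>C outer x x
             + (1 / of_real ((vnorm2 \<Lambda>)\<^sup>2)) *\<^sub>C
                 (cnj (lam ^ j) *\<^sub>C (Px ** outer r x) + lam ^ j *\<^sub>C (outer x r ** Px)))"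
    and "\<Delta>PF = (\<Sum>j\<le>m. monom (\<Delta>AF j) j)"
    and "\<And>j. \<Delta>A2 j =
          (if lam \<in> \<real> then
             (lam ^ j / of_real ((vnorm2 \<Lambda>)\<^sup>2)) *\<^sub>C (outer r x + outer x r - hdot r x *\<^sub>C outer x x)
             - (if cmod (hdot x r) = norm r then 0
                else (lam ^ j * hdot x r
                       / of_real ((vnorm2 \<Lambda>)\<^sup>2 * ((norm r)\<^sup>2 - (cmod (hdot x r))\<^sup>2)))
                     *\<^sub>C (Px ** outer r r ** Px))
           else
             of_real (vec_index rhat j) *\<^sub>C outer x x
             + (1 / of_real ((vnorm2 \<Lambda>)\<^sup>2)) *\<^sub>C
                 (cnj (lam ^ j) *\<^sub>C (Px ** outer r x) + lam ^ j *\<^sub>C (outer x r ** Px))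
             - (if cmod (hdot x r) = norm r then 0
                else of_real (vec_index rhat j / ((norm r)\<^sup>2 - (cmod (hdot x r))\<^sup>2))
                     *\<^sub>C (Px ** outer r r ** Px)))"
    and "\<Delta>P2 = (\<Sum>j\<le>m. monom (\<Delta>A2 j) j)"
  shows "rhat \<in> carrier_vec (m + 1)
    \<and> (lam \<in> \<real> \<longrightarrow>
         backward_error m frobenius_norm (herm_polys m) lam x P
           = sqrt (2 * (norm r)\<^sup>2 - (cmod (hdot x r))\<^sup>2) / vnorm2 \<Lambda>
         \<and> (\<forall>N \<in> {frobenius_norm, spectral_norm}.
              sqrt (2 * (norm r)\<^sup>2 - (cmod (hdot x r))\<^sup>2) / vnorm2 \<Lambda>
                \<le> sqrt 2 * backward_error m N (matrix_polys m) lam x P))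
    \<and> (lam \<notin> \<real> \<longrightarrow>
         backward_error m frobenius_norm (herm_polys m) lam x P
           = sqrt ((vnorm2 rhat)\<^sup>2
                   + 2 * ((norm r)\<^sup>2 - (cmod (hdot x r))\<^sup>2) / (vnorm2 \<Lambda>)\<^sup>2))
    \<and> (lam \<in> \<real> \<longrightarrow>
         (\<forall>N \<in> {frobenius_norm, spectral_norm}.
            backward_error m spectral_norm (herm_polys m) lam x P
              = backward_error m N (matrix_polys m) lam x P))
    \<and> (lam \<notin> \<real> \<longrightarrow>
         backward_error m spectral_norm (herm_polys m) lam x P
           = sqrt ((vnorm2 rhat)\<^sup>2
                   + ((norm r)\<^sup>2 - (cmod (hdot x r))\<^sup>2) / (vnorm2 \<Lambda>)\<^sup>2))
    \<and> (\<forall>\<Delta>P. (\<Delta>P \<in> herm_polys m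
               \<and> mpoly_eval P lam *v x + mpoly_eval \<Delta>P lam *v x = 0
               \<and> mpoly_norm m frobenius_norm \<Delta>P
                   = backward_error m frobenius_norm (herm_polys m) lam x P)
             \<longleftrightarrow> \<Delta>P = \<Delta>PF)
    \<and> (\<Delta>P2 \<in> herm_polys m
       \<and> mpoly_eval P lam *v x + mpoly_eval \<Delta>P2 lam *v x = 0
       \<and> mpoly_norm m spectral_norm \<Delta>P2
           = backward_error m spectral_norm (herm_polys m) lam x P)"
proof -
  have r: "r = - (mpoly_eval P lam *v x)" by fact
  have c_real: "Im (hdot x r) = 0" if "lam \<in> \<real>"
    using hdot_hermitian_residual_real[OF assms(2) that, of x]
    by (simp add: r hdot_def sum_negf)
  obtain \<rho> s t where "pinv (mat_of_rows (m + 1) [map_vec Re (power_vec m lam), map_vec Im (power_vec m lam)])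
       *\<^sub>v vec_of_list [Re (hdot x r), Im (hdot x r)] = Matrix.vec (m + 1) \<rho>"
    and \<rho>: "\<And>j. \<rho> j = s * Re (lam ^ j) + t * Im (lam ^ j)"
      "(\<Sum>j\<le>m. of_real (\<rho> j) * lam ^ j) = hdot x r"
    by (rule pinv_power_vec[of lam "hdot x r" m]) (erule c_real, rule assms(1), rule that)
  then have rhat: "rhat = Matrix.vec (m + 1) \<rho>"
    by (simp only: assms(7,8))
  interpret hermitian_residual m lam x r \<rho> s t
    by unfold_locales (rule assms(4), rule \<rho>(1), rule \<rho>(2))
  have L: "(vnorm2 \<Lambda>)\<^sup>2 = L" "L > 0"
    by (simp_all add: assms(7) vnorm2_power_vec power_norm_sq_pos)
  then have sqrt_L: "vnorm2 \<Lambda> = sqrt L"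
    by (metis real_sqrt_unique vnorm2_def real_sqrt_ge_zero sum_nonneg zero_le_power2)
  have rhat_j: "vec_index rhat j = \<rho> j" if "j \<le> m" for j
    using that by (simp add: rhat)
  have norm_rhat: "(vnorm2 rhat)\<^sup>2 = (\<Sum>j\<le>m. (\<rho> j)\<^sup>2)"
    by (simp add: vnorm2_sq rhat lessThan_Suc_atMost del: sum.lessThan_Suc)
  \<comment> \<open>These collapse the products with \<open>Px\<close> in the stated formulas to
    outer products with \<open>b\<close>.\<close>
  have Px: "Px *v r = b" "ctranspose Px = Px"
    by (simp_all add: assms(6) b_def matrix_vector_mult_diff_rdistrib outer_vector_mult
        ctranspose_diff ctranspose_mat_1 ctranspose_outer)
  note products = matrix_mult_outer outer_matrix_mult Px
  \<comment> \<open>The convention for the last term of \<open>\<Delta>A2\<close> thus concerns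
    exactly \<open>b = 0\<close>, where the correction in \<open>H2\<close> is 0 too.\<close>
  have b0: "b = 0 \<longleftrightarrow> cmod (hdot x r) = norm r"
    using norm_b by (metis norm_eq_zero norm_ge_zero power2_eq_iff_nonneg right_minus_eq zero_eq_power2)
  have "\<Delta>AF j = HF j" if "j \<le> m" for j
    using that HF_real[OF _ c_real that] HF_eq[of j]
    by (simp add: assms(9) L products rhat_j del: complex_cnj_power)
  then have \<Delta>PF: "\<Delta>PF = (\<Sum>j\<le>m. monom (HF j) j)"
    by (simp add: assms(10))
  have "\<Delta>A2 j = H2 j" if "j \<le> m" for j
  proof -
    have "\<Delta>A2 j = HF j - (if b = 0 then 0 else of_real (\<rho> j / (norm b)\<^sup>2) *\<^sub>C outer b b)"
    proof (cases "lam \<in> \<real>")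
      case True
      have "lam ^ j * hdot x r / of_real (L * (norm b)\<^sup>2) = of_real (\<rho> j / (norm b)\<^sup>2)"
        using rho_real[OF True that] by (simp add: field_simps)
      then show ?thesis
        using HF_real[OF True c_real[OF True] that]
        by (simp add: assms(11) True L products b0 add.commute[of "outer r x" "outer x r"]
            del: of_real_mult of_real_divide flip: norm_b)
    next
      case False
      then show ?thesis
        by (simp add: assms(11) HF_eq L products b0 rhat_j that norm_b[symmetric] del: complex_cnj_power)
    qed
    also have "\<dots> = H2 j"
      by (simp only: H2_def cscale_of_real) (simp add: outer_def zero_vec_def)
    finally show ?thesis .
  qed
  then have \<Delta>P2: "\<Delta>P2 = (\<Sum>j\<le>m. monom (H2 j) j)"
    by (simp add: assms(12))
  have frob: "backward_error m norm (herm_polys m) lam x P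
      = sqrt ((\<Sum>j\<le>m. (\<rho> j)\<^sup>2) + 2 * (norm b)\<^sup>2 / L)"
    by (simp add: backward_error_herm_frobenius[OF r] sum_norm_HF)
  have spec: "backward_error m spectral_norm (herm_polys m) lam x P
      = sqrt ((\<Sum>j\<le>m. (\<rho> j)\<^sup>2) + (norm b)\<^sup>2 / L)"
    by (simp add: backward_error_herm_spectral[OF r] sum_norm_w)
  have unstructured: "backward_error m N (matrix_polys m) lam x P = norm r / sqrt L"
    if "N \<in> {norm, spectral_norm}" for N
  proof -
    have "norm (A *v x) \<le> N A" "N (outer a x) \<le> norm a" for A a
      using that frobenius_norm_ge[of A x] spectral_norm_ge[of A x] spectral_norm_outer_le[of a x]
      by (auto simp: norm_x frobenius_norm_outer)
    from backward_error_unstructured[OF assms(4) this] show ?thesis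
      by (simp add: r)
  qed
  have frob_real: "backward_error m norm (herm_polys m) lam x P
      = sqrt (2 * (norm r)\<^sup>2 - (cmod (hdot x r))\<^sup>2) / vnorm2 \<Lambda>" if "lam \<in> \<real>"
    unfolding frob sum_rho_real[OF that] sqrt_L norm_b
    by (simp add: add_divide_distrib[symmetric] flip: real_sqrt_divide)
  have spec_real: "backward_error m spectral_norm (herm_polys m) lam x P = norm r / sqrt L"
    if "lam \<in> \<real>"
    unfolding spec sum_rho_real[OF that] norm_b
    by (simp add: add_divide_distrib[symmetric] real_sqrt_divide)
  have le: "sqrt (2 * (norm r)\<^sup>2 - (cmod (hdot x r))\<^sup>2) / vnorm2 \<Lambda> \<le> sqrt 2 * (norm r / sqrt L)"
  proof -
    have "sqrt (2 * (norm r)\<^sup>2 - (cmod (hdot x r))\<^sup>2) \<le> sqrt (2 * (norm r)\<^sup>2)"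
      by simp
    then show ?thesis
      using L by (simp add: sqrt_L real_sqrt_mult divide_right_mono)
  qed
  have "rhat \<in> carrier_vec (m + 1)"
    by (simp add: rhat)
  then show ?thesis
    using frob_real spec_real le frob spec unstructured optimal_herm_frobenius_iff[OF r]
      H2_residual[OF r] backward_error_herm_spectral(2)[OF r]
    by (simp add: \<Delta>PF \<Delta>P2 norm_rhat norm_b L
        sum_monom_in_herm_polys H2_hermitian)
qed

end
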